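(* Let $n$ be a positive integer. For each positive divisor $d$ of $n$ let $P_{n,d}(X) = \sum_{k=0}^{d-1} X^{kn/d} \in \mathbb{Z}[X]$. Then $$\left\langle P_{n,d} : d > 1,\ d \mid n \right\rangle = \left\langle \Phi_n(X) \right\rangle$$ as ideals in $\mathbb{Z}[X]$, where $\Phi_n$ is the $n$-th cyclotomic polynomial.
   Context: $\langle S\rangle$ denotes the ideal of $\mathbb{Z}[X]$ generated by the set $S$.
   Formalization: The formal theorem assumes n > 1 instead of n positive: for n = 1 there is no divisor d > 1, so the left ideal is generated by the empty set and is zero, while Φ_1 = X − 1 generates a nonzero ideal, so the claim fails there. *)

theory Defs
  imports
    "HOL-Algebra.Algebraic_Closure_Type"
    "HOL-Computational_Algebra.Fundamental_Theorem_Algebra"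
begin

definition primitive_roots_unity :: "nat \<Rightarrow> complex set" where
  "primitive_roots_unity n = {z. z ^ n = 1 \<and> (\<forall>m. 0 < m \<and> m < n \<longrightarrow> z ^ m \<noteq> 1)}"

definition cyclotomic_complex :: "nat \<Rightarrow> complex poly" where
  "cyclotomic_complex n = (\<Prod>z\<in>primitive_roots_unity n. [:- z, 1:])"

text \<open>The \<open>n\<close>-th cyclotomic polynomial as an element of \<open>\<int>[X]\<close>. For \<open>n > 0\<close> the description is
  well-defined by \<open>cyclotomic_unique_exists\<close> below; \<open>cyclotomic 0\<close> is meaningless.\<close>
definition cyclotomic :: "nat \<Rightarrow> int poly" where
  "cyclotomic n = (THE p. map_poly of_int p = cyclotomic_complex n)"

text \<open>The truncating \<open>div\<close> is exact in the intended case \<open>d dvd n\<close>.\<close>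
definition P_poly :: "nat \<Rightarrow> nat \<Rightarrow> int poly" where
  "P_poly n d = (\<Sum>k<d. Polynomial.monom 1 (k * n div d))"

lemma map_poly_of_int_mult:
  "map_poly of_int (p * q) = (map_poly of_int p * map_poly of_int q :: complex poly)"
  by (rule poly_eqI) (simp add: coeff_map_poly coeff_mult)

lemma map_poly_of_int_add:
  "map_poly of_int (p + q) = (map_poly of_int p + map_poly of_int q :: complex poly)"
  by (rule poly_eqI) (simp add: coeff_map_poly)

lemma map_poly_of_int_prod:
  "map_poly of_int (\<Prod>x\<in>A. f x) = (\<Prod>x\<in>A. map_poly of_int (f x) :: complex poly)"
  by (induction A rule: infinite_finite_induct) (simp_all add: map_poly_of_int_mult)

lemma map_poly_of_int_inj:
  "(map_poly of_int p :: complex poly) = map_poly of_int q \<longleftrightarrow> p = q"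
  by (auto simp: poly_eq_iff coeff_map_poly)

lemma degree_map_poly_of_int:
  "Polynomial.degree (map_poly of_int p :: complex poly) = Polynomial.degree p"
  by (cases "p = 0") (auto intro!: map_poly_degree_eq)

lemma X_power_minus_one_decompose:
  assumes "n > 0"
  shows "(\<Prod>z | z ^ n = 1. [:- z, 1:]) = Polynomial.monom (1 :: complex) n - 1"
proof -
  let ?p = "Polynomial.monom (1 :: complex) n - 1"
  have deg: "Polynomial.degree ?p = n"
    using assms degree_add_eq_left[of "- 1" "Polynomial.monom (1 :: complex) n"]
    by (simp add: degree_monom_eq)
  have c: "lead_coeff ?p = 1"
    unfolding deg using assms by (simp add: coeff_1)
  have "rsquarefree ?p"
    unfolding rsquarefree_roots
    using assms by (auto simp: pderiv_diff pderiv_monom poly_monom power_0_left)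
  from complex_poly_decompose_rsquarefree[OF this] show ?thesis
    unfolding c by (simp add: poly_monom)
qed

lemma roots_unity_eq_UN:
  assumes "n > 0"
  shows "{z :: complex. z ^ n = 1} = (\<Union>d\<in>{d. d dvd n}. primitive_roots_unity d)"
proof (intro equalityI subsetI)
  fix z :: complex assume z: "z \<in> {z. z ^ n = 1}"
  define d where "d = (LEAST d. d > 0 \<and> z ^ d = 1)"
  have d: "d > 0 \<and> z ^ d = 1"
    unfolding d_def by (rule LeastI[of _ n]) (use z assms in auto)
  have least: "z ^ m \<noteq> 1" if "0 < m" "m < d" for m
    using not_less_Least[of m "\<lambda>d. d > 0 \<and> z ^ d = 1"] that unfolding d_def by auto
  have "z ^ n = z ^ (d * (n div d) + n mod d)" by simp
  also have "\<dots> = z ^ (n mod d)" using d by (simp only: power_add power_mult) simp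
  finally have "z ^ (n mod d) = 1" using z by simp
  moreover have "n mod d < d" using d by simp
  ultimately have "n mod d = 0" using least by blast
  then show "z \<in> (\<Union>d\<in>{d. d dvd n}. primitive_roots_unity d)"
    using d least by (auto simp: primitive_roots_unity_def)
qed (auto simp: primitive_roots_unity_def power_mult elim!: dvdE)

lemma primitive_roots_unity_disjoint:
  assumes "d > 0" "e > 0" "d \<noteq> e"
  shows "primitive_roots_unity d \<inter> primitive_roots_unity e = {}"
  using assms by (cases d e rule: linorder_cases) (auto simp: primitive_roots_unity_def)

lemma finite_primitive_roots_unity:
  assumes "n > 0"
  shows "finite (primitive_roots_unity n)"
  by (rule finite_subset[OF _ finite_roots_unity[of n]])
    (use assms in \<open>auto simp: primitive_roots_unity_def\<close>)

lemma prod_cyclotomic_complex: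
  assumes "n > 0"
  shows "(\<Prod>d | d dvd n. cyclotomic_complex d) = Polynomial.monom 1 n - 1"
proof -
  have pos: "d > 0" if "d dvd n" for d using that assms by (rule dvd_pos_nat[rotated])
  have "(\<Prod>z\<in>(\<Union>d\<in>{d. d dvd n}. primitive_roots_unity d). [:- z, 1:])
      = (\<Prod>d | d dvd n. cyclotomic_complex d)"
    unfolding cyclotomic_complex_def
    by (rule prod.UNION_disjoint)
      (use assms pos finite_primitive_roots_unity primitive_roots_unity_disjoint in auto)
  then show ?thesis
    using X_power_minus_one_decompose[OF assms] roots_unity_eq_UN[OF assms] by simp
qed

lemma cyclotomic_complex_integral:
  "n > 0 \<Longrightarrow> \<exists>p. map_poly of_int p = cyclotomic_complex n"
proof (induction n rule: less_induct)
  case (less n)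
  define D where "D = {d. d dvd n} - {n}"
  have fin: "finite {d. d dvd n}" using less.prems by simp
  have "\<exists>p. map_poly of_int p = cyclotomic_complex d" if "d \<in> D" for d
  proof (rule less.IH)
    have "d dvd n" "d \<noteq> n" using that by (auto simp: D_def)
    then show "d < n" "d > 0"
      using less.prems dvd_imp_le[of d n] by (auto intro: Nat.gr0I)
  qed
  then obtain f where f: "\<And>d. d \<in> D \<Longrightarrow> map_poly of_int (f d) = cyclotomic_complex d"
    by metis
  define q where "q = (\<Prod>d\<in>D. f d)"
  define Q :: "complex poly" where "Q = map_poly of_int q"
  define F :: "int poly" where "F = Polynomial.monom 1 n - 1"
  have Q: "Q = (\<Prod>d\<in>D. cyclotomic_complex d)"
    using f by (simp add: Q_def q_def map_poly_of_int_prod)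
  have "lead_coeff Q = 1"
    unfolding Q cyclotomic_complex_def by (simp add: lead_coeff_prod)
  then have "of_int (lead_coeff q) = (1 :: complex)"
    by (simp add: Q_def degree_map_poly_of_int coeff_map_poly)
  then have q1: "lead_coeff q = 1" by simp
  then have q0: "q \<noteq> 0" by auto
  have F: "map_poly of_int F = cyclotomic_complex n * Q"
  proof -
    have "(map_poly of_int F :: complex poly) = Polynomial.monom 1 n - 1"
      by (rule poly_eqI) (simp add: F_def coeff_map_poly)
    also have "\<dots> = cyclotomic_complex n * Q"
      unfolding Q D_def prod_cyclotomic_complex[OF less.prems, symmetric]
      using fin by (subst prod.remove[of _ n]) auto
    finally show ?thesis .
  qed
  obtain a r where ar: "pseudo_divmod F q = (a, r)" by fastforce
  have Fqar: "F = q * a + r" and r: "r = 0 \<or> Polynomial.degree r < Polynomial.degree q"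
    using pseudo_divmod[OF q0 ar] q1 by auto
  have eq: "Q * (cyclotomic_complex n - map_poly of_int a) = map_poly of_int r"
    using F unfolding Fqar
    by (simp add: map_poly_of_int_add map_poly_of_int_mult Q_def algebra_simps)
  have "cyclotomic_complex n - map_poly of_int a = 0"
  proof (rule ccontr)
    assume nz: "cyclotomic_complex n - map_poly of_int a \<noteq> 0"
    have Qnz: "Q \<noteq> 0" using \<open>lead_coeff Q = 1\<close> by auto
    have "Polynomial.degree (Q * (cyclotomic_complex n - map_poly of_int a)) \<ge> Polynomial.degree Q"
      using degree_mult_eq[OF Qnz nz] by linarith
    then have "Polynomial.degree q \<le> Polynomial.degree r"
      unfolding eq by (simp add: Q_def degree_map_poly_of_int)
    moreover have "r \<noteq> 0"
      using eq nz Qnz by auto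
    ultimately show False using r by simp
  qed
  then show ?case by auto
qed

lemma cyclotomic_unique_exists:
  assumes "n > 0"
  shows "\<exists>!p. map_poly of_int p = cyclotomic_complex n"
  using cyclotomic_complex_integral[OF assms] map_poly_of_int_inj by metis

lemma map_poly_cyclotomic:
  assumes "n > 0"
  shows "map_poly of_int (cyclotomic n) = cyclotomic_complex n"
  unfolding cyclotomic_def by (rule theI'[OF cyclotomic_unique_exists[OF assms]])

text \<open>For \<open>n = 1\<close> there is no divisor \<open>d > 1\<close>, so the left-hand ideal is zero while \<open>\<Phi>\<^sub>1\<close> is not;
  the equality of ideals can only hold for \<open>n > 1\<close>.\<close>
lemma ideals_differ_at_1:
  "Idl\<^bsub>ring_of_type_algebra\<^esub> {P_poly 1 d | d. d > 1 \<and> d dvd 1}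
    \<noteq> Idl\<^bsub>ring_of_type_algebra\<^esub> {cyclotomic 1}"
proof
  interpret cring "ring_of_type_algebra :: int poly ring" by (rule cring_from_type_algebra)
  let ?R = "ring_of_type_algebra :: int poly ring"
  assume eq: "Idl\<^bsub>?R\<^esub> {P_poly 1 d | d. d > 1 \<and> d dvd 1} = Idl\<^bsub>?R\<^esub> {cyclotomic 1}"
  have empty: "{P_poly 1 d | d. d > 1 \<and> d dvd 1} = {}" by auto
  have "cyclotomic 1 \<in> Idl\<^bsub>?R\<^esub> {cyclotomic 1}"
    using genideal_self[of "{cyclotomic 1}"] by (simp add: ring_of_type_algebra_def)
  also have "\<dots> \<subseteq> {0}"
    unfolding eq[symmetric] empty
    using genideal_minimal[OF zeroideal, of "{}"] by (simp add: ring_of_type_algebra_def)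
  finally have "cyclotomic_complex 1 = 0"
    using map_poly_cyclotomic[of 1] by simp
  moreover have "finite (primitive_roots_unity 1)" by (rule finite_primitive_roots_unity) simp
  ultimately show False by (simp add: cyclotomic_complex_def)
qed

end

theory Submission
  imports Defs
begin

text \<open>Since \<open>P\<^sub>n\<^sub>,\<^sub>d = (X\<^sup>n - 1) / (X\<^bsup>n/d\<^esup> - 1)\<close> is the product of the \<open>\<Phi>\<^sub>e\<close> with \<open>e dvd n\<close> and
  \<open>\<not> e dvd n/d\<close>, it is a multiple of \<open>\<Phi>\<^sub>n\<close> for \<open>d > 1\<close>. For the converse, \<open>\<Phi>\<^sub>e\<close> and \<open>\<Phi>\<^sub>f\<close> generate the
  unit ideal of \<open>\<int>[X]\<close> whenever neither of \<open>e, f\<close> divides the other: with \<open>g = gcd e f\<close>, they divide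
  \<open>(X\<^sup>e - 1) / (X\<^sup>g - 1)\<close> and \<open>(X\<^sup>f - 1) / (X\<^sup>g - 1)\<close>, which are comaximal by Euclid's algorithm on the
  exponents. Hence, adding one prime divisor \<open>p\<close> of \<open>n\<close> at a time to a set \<open>S\<close>, the product of the
  \<open>\<Phi>\<^sub>e\<close> with \<open>e dvd n\<close> and \<open>\<not> e dvd n/p\<close> for all \<open>p \<in> S\<close> stays in the ideal generated by the
  \<open>P\<^sub>n\<^sub>,\<^sub>p\<close>. Once \<open>S\<close> contains all prime divisors of \<open>n\<close>, this product is \<open>\<Phi>\<^sub>n\<close>.\<close>

section \<open>Comaximal elements of a commutative ring\<close>

definition comaximal :: "'a::comm_ring_1 \<Rightarrow> 'a \<Rightarrow> bool" where
  "comaximal a b \<longleftrightarrow> (\<exists>u v. u * a + v * b = 1)"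

lemma comaximalI: "u * a + v * b = 1 \<Longrightarrow> comaximal a b"
  unfolding comaximal_def by blast

lemma comaximal_commute: "comaximal a b \<longleftrightarrow> comaximal b a"
  unfolding comaximal_def by (metis add.commute)

lemma comaximal_dvd_mono:
  assumes "comaximal c d" "a dvd c" "b dvd d"
  shows "comaximal a b"
proof -
  obtain u v where "u * c + v * d = 1" using assms(1) unfolding comaximal_def by blast
  moreover obtain r s where "c = a * r" "d = b * s" using assms(2,3) by (elim dvdE)
  ultimately have "(u * r) * a + (v * s) * b = 1" by (simp add: mult_ac)
  then show ?thesis by (rule comaximalI)
qed

text \<open>Multiplying the two Bezout identities leaves a multiple of \<open>a * b\<close> plus a
  multiple of \<open>c\<close>.\<close>

lemma comaximal_mult_left:
  assumes "comaximal a c" "comaximal b c"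
  shows "comaximal (a * b) c"
proof -
  obtain u v where 1: "u * a + v * c = 1" using assms(1) unfolding comaximal_def by blast
  obtain r s where 2: "r * b + s * c = 1" using assms(2) unfolding comaximal_def by blast
  have "(u * r) * (a * b) + (u * a * s + v * r * b + v * s * c) * c
      = (u * a + v * c) * (r * b + s * c)"
    by (simp add: algebra_simps)
  then show ?thesis unfolding 1 2 by (intro comaximalI) simp
qed

lemma comaximal_prod_left:
  assumes "\<And>i. i \<in> I \<Longrightarrow> comaximal (f i) c"
  shows "comaximal (\<Prod>i\<in>I. f i) c"
  using assms
proof (induction I rule: infinite_finite_induct)
  case (insert i I)
  then show ?case by (simp add: comaximal_mult_left)
\<comment> \<open>Over an empty or infinite index set the product is 1.\<close>
qed (auto intro: comaximalI[of 1 _ 0])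

lemma comaximal_prod_prod:
  assumes "\<And>i j. i \<in> I \<Longrightarrow> j \<in> J \<Longrightarrow> comaximal (f i) (g j)"
  shows "comaximal (\<Prod>i\<in>I. f i) (\<Prod>j\<in>J. g j)"
  by (intro comaximal_prod_left) (metis comaximal_commute comaximal_prod_left assms)

text \<open>Modulo \<open>x ^ b - 1\<close> the power \<open>x ^ b\<close> is 1, so
  \<open>x ^ a - 1\<close> reduces to \<open>x ^ (a mod b) - 1\<close>.\<close>

lemma power_minus_one_gcd_combination:
  fixes x :: "'a::comm_ring_1"
  shows "\<exists>u v. u * (x ^ a - 1) + v * (x ^ b - 1) = x ^ gcd a b - 1"
proof (induction a b rule: gcd_nat_induct)
  case (base a)
  have "1 * (x ^ a - 1) + 0 * (x ^ 0 - 1) = x ^ gcd a 0 - 1" by simp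
  then show ?case by blast
next
  case (step a b)
  then obtain u v where uv:
    "u * (x ^ b - 1) + v * (x ^ (a mod b) - 1) = x ^ gcd b (a mod b) - 1" by blast
  have "x ^ b - 1 dvd x ^ (b * (a div b)) - 1"
    unfolding power_mult by (metis dvd_triv_left power_diff_1_eq)
  then obtain c where c: "x ^ (b * (a div b)) = (x ^ b - 1) * c + 1"
    by (metis dvdE diff_eq_eq)
  have "x ^ a = x ^ (a mod b + b * (a div b))" by simp
  also have "\<dots> = x ^ (a mod b) * ((x ^ b - 1) * c + 1)" by (simp only: power_add c)
  finally have a: "x ^ a = x ^ (a mod b) * ((x ^ b - 1) * c + 1)" .
  have "v * (x ^ a - 1) + (u - v * x ^ (a mod b) * c) * (x ^ b - 1)
      = u * (x ^ b - 1) + v * (x ^ (a mod b) - 1)"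
    unfolding a by (simp add: algebra_simps)
  then show ?case unfolding uv using gcd_red_nat[of a b] by metis
qed

section \<open>Cyclotomic factorizations and comaximality\<close>

lemma prod_cyclotomic:
  assumes "n > 0"
  shows "(\<Prod>d | d dvd n. cyclotomic d) = Polynomial.monom 1 n - 1"
proof -
  have pos: "d > 0" if "d dvd n" for d using that assms by (rule dvd_pos_nat[rotated])
  have "map_poly of_int (Polynomial.monom 1 n - 1 :: int poly) = (Polynomial.monom 1 n - 1 :: complex poly)"
    by (rule poly_eqI) (simp add: coeff_map_poly)
  also have "\<dots> = map_poly of_int (\<Prod>d | d dvd n. cyclotomic d)"
    using pos by (simp add: map_poly_of_int_prod map_poly_cyclotomic flip: prod_cyclotomic_complex[OF assms])
  finally show ?thesis unfolding map_poly_of_int_inj by (rule sym)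
qed

lemma monom_minus_one_nonzero:
  assumes "n > 0"
  shows "Polynomial.monom 1 n - 1 \<noteq> (0 :: int poly)"
proof
  assume "Polynomial.monom 1 n - 1 = (0 :: int poly)"
  then have "Polynomial.coeff (Polynomial.monom 1 n - 1 :: int poly) n = 0" by simp
  then show False using assms by (simp add: coeff_1)
qed

lemma monom_minus_one_factor:
  assumes "n > 0" "m dvd n"
  shows "Polynomial.monom 1 n - 1
    = (Polynomial.monom 1 m - 1) * (\<Prod>e | e dvd n \<and> \<not> e dvd m. cyclotomic e)"
proof -
  have m: "m > 0" using assms by (rule dvd_pos_nat)
  have "{e. e dvd n} = {e. e dvd m} \<union> {e. e dvd n \<and> \<not> e dvd m}"
    using assms(2) by (auto intro: dvd_trans)
  then have "(\<Prod>e | e dvd n. cyclotomic e)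
      = (\<Prod>e | e dvd m. cyclotomic e) * (\<Prod>e | e dvd n \<and> \<not> e dvd m. cyclotomic e)"
    using assms m by (subst prod.union_disjoint[symmetric]) auto
  then show ?thesis using assms m by (simp add: prod_cyclotomic)
qed

text \<open>With \<open>m = n div d\<close>, \<open>P_poly n d\<close> is a geometric sum in
  \<open>X^m\<close>, so it is the cofactor of \<open>X^m - 1\<close> in \<open>X^n - 1\<close>;
  cancel \<open>X^m - 1\<close>.\<close>

lemma P_poly_eq_prod_cyclotomic:
  assumes "n > 0" "d dvd n"
  shows "P_poly n d = (\<Prod>e | e dvd n \<and> \<not> e dvd n div d. cyclotomic e)"
proof -
  define m where "m = n div d"
  have n: "n = d * m" using assms(2) by (simp add: m_def)
  then have d: "d > 0" and m: "m > 0" using assms(1) by auto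
  have pow: "(Polynomial.monom 1 m :: int poly) ^ k = Polynomial.monom 1 (k * m)" for k
    by (simp add: monom_power mult.commute)
  have "k * n div d = k * m" for k using d by (simp add: n mult.left_commute)
  then have "P_poly n d = (\<Sum>k<d. Polynomial.monom 1 m ^ k)"
    by (simp add: P_poly_def pow)
  then have "(Polynomial.monom 1 m - 1) * P_poly n d = Polynomial.monom 1 m ^ d - 1"
    by (simp only: power_diff_1_eq)
  also have "\<dots> = Polynomial.monom 1 n - 1" by (simp add: pow n)
  also have "\<dots> = (Polynomial.monom 1 m - 1) * (\<Prod>e | e dvd n \<and> \<not> e dvd m. cyclotomic e)"
    by (rule monom_minus_one_factor) (use assms n in auto)
  finally show ?thesis using monom_minus_one_nonzero[OF m] unfolding m_def by simp
qed

lemma cyclotomic_dvd_P_poly: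
  assumes "n > 0" "d dvd n" "d > 1"
  shows "cyclotomic n dvd P_poly n d"
proof -
  \<comment> \<open>As \<open>0 < n div d < n\<close>, the index \<open>n\<close> occurs in the
    product for \<open>P_poly n d\<close>.\<close>
  have "\<not> n dvd n div d"
    using assms by (auto dest!: dvd_imp_le elim!: dvdE)
  then show ?thesis unfolding P_poly_eq_prod_cyclotomic[OF assms(1,2)]
    using assms(1) by (intro dvd_prodI) auto
qed

lemma comaximal_cyclotomic:
  assumes "e > 0" "f > 0" "\<not> e dvd f" "\<not> f dvd e"
  shows "comaximal (cyclotomic e) (cyclotomic f)"
proof -
  define g where "g = gcd e f"
  define x :: "int poly" where "x = Polynomial.monom 1 1"
  have pow: "x ^ k = Polynomial.monom 1 k" for k by (simp add: x_def monom_power)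
  have g: "g > 0" "g dvd e" "g dvd f" using assms by (auto simp: g_def)
  \<comment> \<open>For \<open>h\<close> equal to \<open>e\<close> or \<open>f\<close>,
    \<open>A h\<close> is the quotient of \<open>X^h - 1\<close> by \<open>X^g - 1\<close>.\<close>
  define A where "A h = (\<Prod>i | i dvd h \<and> \<not> i dvd g. cyclotomic i)" for h
  have A: "x ^ e - 1 = (x ^ g - 1) * A e" "x ^ f - 1 = (x ^ g - 1) * A f"
    unfolding A_def pow using assms g by (blast intro: monom_minus_one_factor)+
  obtain u v where "u * (x ^ e - 1) + v * (x ^ f - 1) = x ^ g - 1"
    using power_minus_one_gcd_combination unfolding g_def by blast
  then have "(x ^ g - 1) * (u * A e + v * A f) = (x ^ g - 1) * 1"
    unfolding A by (simp add: algebra_simps)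
  then have "u * A e + v * A f = 1"
    using monom_minus_one_nonzero[OF g(1)] unfolding pow mult_cancel_left by blast
  then have "comaximal (A e) (A f)" by (rule comaximalI)
  moreover have "\<not> e dvd g" "\<not> f dvd g" using assms by (auto simp: g_def)
  then have "cyclotomic e dvd A e" "cyclotomic f dvd A f"
    unfolding A_def using assms by (auto intro!: dvd_prodI)
  ultimately show ?thesis by (rule comaximal_dvd_mono)
qed

section \<open>Full divisors and membership in the ideal\<close>

text \<open>The divisors \<open>e\<close> of \<open>n\<close> whose \<open>p\<close>-adic valuation is that of \<open>n\<close> for each prime \<open>p \<in> S\<close>.\<close>
definition full_divisors :: "nat \<Rightarrow> nat set \<Rightarrow> nat set" where
  "full_divisors n S = {e. e dvd n \<and> (\<forall>p\<in>S. \<not> e dvd n div p)}"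

text \<open>If \<open>n = e * k\<close> with \<open>k \<noteq> 1\<close>, a prime \<open>p\<close>
  dividing \<open>k\<close> gives \<open>e dvd n div p\<close>.\<close>

lemma full_divisors_prime_factors:
  assumes "n > 0"
  shows "full_divisors n (prime_factors n) = {n}"
proof (intro equalityI subsetI)
  fix e assume e: "e \<in> full_divisors n (prime_factors n)"
  then obtain k where k: "n = e * k" by (auto simp: full_divisors_def)
  have "k = 1"
  proof (rule ccontr)
    assume "k \<noteq> 1"
    then obtain p where p: "prime p" "p dvd k" using prime_factor_nat by blast
    then have "p \<in> prime_factors n" "e dvd n div p"
      using assms k by (auto simp: prime_factors_dvd div_mult_swap[symmetric])
    then show False using e by (auto simp: full_divisors_def)
  qed
  then show "e \<in> {n}" using k by simp
next
  fix e assume "e \<in> {n}"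
  moreover have "\<not> n dvd n div p" if "p \<in> prime_factors n" for p
  proof -
    have "prime p" "p dvd n" using that by auto
    then have "n div p < n" "n div p > 0"
      using assms prime_gt_1_nat[of p] by (auto simp: div_greater_zero_iff intro: dvd_imp_le)
    then show ?thesis by (auto dest: dvd_imp_le)
  qed
  ultimately show "e \<in> full_divisors n (prime_factors n)" by (auto simp: full_divisors_def)
qed

lemma prod_full_divisors_in_ideal:
  fixes I :: "int poly set"
  assumes "n > 1"
    and add: "\<And>a b. a \<in> I \<Longrightarrow> b \<in> I \<Longrightarrow> a + b \<in> I"
    and mult: "\<And>a b. b \<in> I \<Longrightarrow> a * b \<in> I"
    and P: "\<And>p. p \<in> prime_factors n \<Longrightarrow> P_poly n p \<in> I"
    and "finite S" "S \<subseteq> prime_factors n"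
  shows "(\<Prod>e\<in>full_divisors n S. cyclotomic e) \<in> I"
  using assms(5,6)
proof (induction S rule: finite_induct)
  case empty
  \<comment> \<open>For empty \<open>S\<close> the product is \<open>X^n - 1\<close>, a multiple of
    \<open>P_poly n p\<close> for any prime \<open>p\<close> dividing \<open>n\<close>.\<close>
  obtain p where p: "prime p" "p dvd n" using assms(1) prime_factor_nat[of n] by auto
  then have "Polynomial.monom 1 n - 1 = (Polynomial.monom 1 (n div p) - 1) * P_poly n p"
    using assms(1) monom_minus_one_factor[of n "n div p"]
    by (simp add: P_poly_eq_prod_cyclotomic div_dvd_iff_mult)
  moreover have "P_poly n p \<in> I" using p assms(1) by (intro P) (auto simp: prime_factors_dvd)
  ultimately show ?case
    using assms(1) mult by (simp add: full_divisors_def prod_cyclotomic)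
next
  case (insert p S)
  \<comment> \<open>\<open>C\<close> indexes the common factors of the old product and
    \<open>P_poly n p\<close>; \<open>A\<close> and \<open>B\<close> index what remains of
    each.\<close>
  define C where "C = full_divisors n (insert p S)"
  define A where "A = {e \<in> full_divisors n S. e dvd n div p}"
  define D where "D = {e. e dvd n \<and> \<not> e dvd n div p}"
  define B where "B = D - C"
  have p: "p \<in> prime_factors n" using insert.prems by simp
  have fin: "finite C" "finite A" "finite B"
    using assms(1) by (auto simp: C_def A_def B_def D_def full_divisors_def)
  have S: "full_divisors n S = A \<union> C" "A \<inter> C = {}"
    by (auto simp: A_def C_def full_divisors_def)
  have D: "D = B \<union> C" "B \<inter> C = {}"
    by (auto simp: B_def C_def D_def full_divisors_def)
  have "comaximal (cyclotomic e) (cyclotomic f)" if e: "e \<in> A" and f: "f \<in> B" for e f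
  proof (rule comaximal_cyclotomic)
    have "e dvd n" "f dvd n" using e f by (auto simp: A_def B_def D_def full_divisors_def)
    then show "e > 0" "f > 0" using assms(1) by (auto intro: dvd_pos_nat[of n])
    \<comment> \<open>Since \<open>f\<close> passes the test at \<open>p\<close> but is not in
      \<open>C\<close>, it fails at some \<open>q \<in> S\<close>, where \<open>e\<close>
      passes.\<close>
    obtain q where q: "q \<in> S" "f dvd n div q"
      using f by (auto simp: B_def C_def D_def full_divisors_def)
    then have "\<not> e dvd n div q" using e by (auto simp: A_def full_divisors_def)
    then show "\<not> e dvd f" using q by (auto dest: dvd_trans)
    show "\<not> f dvd e" using e f by (auto simp: A_def B_def D_def dest: dvd_trans)
  qed
  then have "comaximal (\<Prod>e\<in>A. cyclotomic e) (\<Prod>e\<in>B. cyclotomic e)"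
    by (rule comaximal_prod_prod)
  then obtain u v where uv: "u * (\<Prod>e\<in>A. cyclotomic e) + v * (\<Prod>e\<in>B. cyclotomic e) = 1"
    unfolding comaximal_def by blast
  have "P_poly n p = (\<Prod>e\<in>B. cyclotomic e) * (\<Prod>e\<in>C. cyclotomic e)"
    using assms(1) p fin D
    by (subst P_poly_eq_prod_cyclotomic) (auto simp: prod.union_disjoint simp flip: D_def)
  moreover have "(\<Prod>e\<in>full_divisors n S. cyclotomic e)
      = (\<Prod>e\<in>A. cyclotomic e) * (\<Prod>e\<in>C. cyclotomic e)"
    using fin S by (simp add: prod.union_disjoint)
  \<comment> \<open>The Bezout identity for \<open>A\<close> and \<open>B\<close>, multiplied by the
    product over \<open>C\<close>.\<close>
  ultimately have "u * (\<Prod>e\<in>full_divisors n S. cyclotomic e) + v * P_poly n p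
      = (u * (\<Prod>e\<in>A. cyclotomic e) + v * (\<Prod>e\<in>B. cyclotomic e)) * (\<Prod>e\<in>C. cyclotomic e)"
    by (simp add: algebra_simps)
  then have "(\<Prod>e\<in>C. cyclotomic e)
      = u * (\<Prod>e\<in>full_divisors n S. cyclotomic e) + v * P_poly n p"
    by (simp add: uv)
  moreover have "(\<Prod>e\<in>full_divisors n S. cyclotomic e) \<in> I" using insert by simp
  ultimately show ?case using add mult P[OF p] unfolding C_def by simp
qed

theorem theorem3p1:
  fixes n :: nat
  assumes "n > 1"
  shows "Idl\<^bsub>ring_of_type_algebra\<^esub> {P_poly n d | d. d > 1 \<and> d dvd n}
       = Idl\<^bsub>ring_of_type_algebra\<^esub> {cyclotomic n}"
proof -
  let ?R = "ring_of_type_algebra :: int poly ring"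
  let ?G = "{P_poly n d | d. d > 1 \<and> d dvd n}"
  interpret cring ?R by (rule cring_from_type_algebra)
  \<comment> \<open>These translate the record operations into those of the type
    \<open>int poly\<close>.\<close>
  have R: "carrier ?R = UNIV" "\<And>a b. a \<oplus>\<^bsub>?R\<^esub> b = a + b" "\<And>a b. a \<otimes>\<^bsub>?R\<^esub> b = a * b"
    by (simp_all add: ring_of_type_algebra_def)
  have ideals: "ideal (Idl\<^bsub>?R\<^esub> ?G) ?R" "ideal (Idl\<^bsub>?R\<^esub> {cyclotomic n}) ?R"
    by (intro genideal_ideal; simp add: R)+
  interpret J: ideal "Idl\<^bsub>?R\<^esub> ?G" ?R by (rule ideals)
  interpret K: ideal "Idl\<^bsub>?R\<^esub> {cyclotomic n}" ?R by (rule ideals)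
  have gen: "?G \<subseteq> Idl\<^bsub>?R\<^esub> ?G" "cyclotomic n \<in> Idl\<^bsub>?R\<^esub> {cyclotomic n}"
    using genideal_self[of ?G] genideal_self[of "{cyclotomic n}"] by (auto simp: R)
  have "?G \<subseteq> Idl\<^bsub>?R\<^esub> {cyclotomic n}"
  proof
    fix a assume "a \<in> ?G"
    then have "cyclotomic n dvd a" using assms cyclotomic_dvd_P_poly by auto
    then obtain b where "a = b * cyclotomic n" by (metis dvdE mult.commute)
    then show "a \<in> Idl\<^bsub>?R\<^esub> {cyclotomic n}"
      using K.I_l_closed[OF gen(2), of b] by (simp add: R)
  qed
  moreover have "(\<Prod>e\<in>full_divisors n (prime_factors n). cyclotomic e) \<in> Idl\<^bsub>?R\<^esub> ?G"
  proof (rule prod_full_divisors_in_ideal[OF assms])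
    show "a + b \<in> Idl\<^bsub>?R\<^esub> ?G" if "a \<in> Idl\<^bsub>?R\<^esub> ?G" "b \<in> Idl\<^bsub>?R\<^esub> ?G" for a b
      using J.a_closed[OF that] by (simp add: R)
    show "a * b \<in> Idl\<^bsub>?R\<^esub> ?G" if "b \<in> Idl\<^bsub>?R\<^esub> ?G" for a b
      using J.I_l_closed[OF that, of a] by (simp add: R)
    show "P_poly n p \<in> Idl\<^bsub>?R\<^esub> ?G" if "p \<in> prime_factors n" for p
    proof -
      have "p > 1" "p dvd n" using that by (auto intro: prime_gt_1_nat simp del: One_nat_def)
      then show ?thesis using gen(1) by blast
    qed
  qed simp_all
  then have "cyclotomic n \<in> Idl\<^bsub>?R\<^esub> ?G"
    using assms by (simp add: full_divisors_prime_factors)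
  ultimately show ?thesis
    by (intro equalityI genideal_minimal ideals) auto
qed

end
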